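(* Let $a>0$, $b>0$ and $p>0$ be given constants, and assume that $0<p<1$ or $3<p<\infty$. Consider the problem $$-(b+a\Vert u'\Vert^2)\,u''(x)=\lambda u(x)^p,\ x\in I,\qquad u(x)>0,\ x\in I,\qquad u(\pm1)=0, \qquad ( * )$$ on $I=(-1,1)$. Then for any $\lambda>0$ there exists a unique solution pair $(\lambda,u_\lambda)\in\mathbb{R}_+\times C^2(\bar I)$ of $( * )$. Put $\xi:=\Vert u_\lambda\Vert_\infty$. Then $\lambda$ is parameterized by $\xi$ as $\lambda=\lambda(\xi)$, and the following formula holds for $\xi>0$: $$\lambda(\xi)=\frac{p+1}{2}A_p^2\left(2A_pB_p\,a\,\xi^{3-p}+b\,\xi^{1-p}\right).$$ Furthermore, $u_\lambda(x)$ is given by $$u_\lambda(x)=\left(\frac{\lambda}{\sqrt{b+2A_pB_p\,a\,\xi(\lambda)^2}}\right)^{1/(1-p)}W_p(x),$$ where $\xi(\lambda)$ is the inverse function of $\lambda(\xi)$.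
   Context: $I:=(-1,1)$, $\Vert u'\Vert:=\left(\int_I u'(x)^2\,dx\right)^{1/2}$, $\Vert\cdot\Vert_\infty$ is the maximum norm on $\bar I$, and $\mathbb{R}_+=(0,\infty)$. The constants are $$A_p:=\int_0^1\frac{1}{\sqrt{1-s^{p+1}}}\,ds,\qquad B_p:=\int_0^1\sqrt{1-s^{p+1}}\,ds.$$ For $p>0$, $p\neq1$, $W_p$ denotes the unique solution (known to exist and be unique) of $-W''(x)=W(x)^p$ and $W(x)>0$ for $x\in I$, $W(-1)=W(1)=0$. The function $\lambda(\xi)$ is strictly increasing in $\xi>0$ if $0<p<1$ and strictly decreasing if $3<p<\infty$, so that its inverse $\xi(\lambda)$ exists.
   Formalization: The printed formula for u_λ has a square root around b+2A_pB_p aξ(λ)², which is false unless that quantity equals 1 (substitute u=cW_p into the equation); the formal statement uses λ/(b+2A_pB_p aξ(λ)²) without the square root. *)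

theory Defs
  imports "HOL-Analysis.Analysis"
begin

(* Functions on the closed interval [-1,1] are total functions real => real whose values off
   [-1,1] are irrelevant. At the end points D is the one-sided derivative; at interior points it
   is the ordinary one. *)
definition D :: "(real \<Rightarrow> real) \<Rightarrow> real \<Rightarrow> real" where
  "D u x = vector_derivative u (at x within {-1..1})"

definition C2_Ibar :: "(real \<Rightarrow> real) set" where
  "C2_Ibar = {u. u differentiable_on {-1..1} \<and> D u differentiable_on {-1..1}
                 \<and> continuous_on {-1..1} (D (D u))}"

definition L2_norm_I :: "(real \<Rightarrow> real) \<Rightarrow> real" where
  "L2_norm_I v = sqrt (integral {-1<..<1} (\<lambda>x. (v x)\<^sup>2))"

definition max_norm :: "(real \<Rightarrow> real) \<Rightarrow> real" where
  "max_norm u = (SUP x\<in>{-1..1}. \<bar>u x\<bar>)"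

(* The value of the integrand at the singular point s = 1 is immaterial. *)
definition A_const :: "real \<Rightarrow> real" where
  "A_const p = integral {0..1} (\<lambda>s. 1 / sqrt (1 - s powr (p + 1)))"

definition B_const :: "real \<Rightarrow> real" where
  "B_const p = integral {0..1} (\<lambda>s. sqrt (1 - s powr (p + 1)))"

definition kirchhoff_solution ::
    "real \<Rightarrow> real \<Rightarrow> real \<Rightarrow> real \<Rightarrow> (real \<Rightarrow> real) \<Rightarrow> bool" where
  "kirchhoff_solution a b p \<mu> u \<longleftrightarrow>
     u \<in> C2_Ibar
     \<and> (\<forall>x\<in>{-1<..<1}. - (b + a * (L2_norm_I (D u))\<^sup>2) * D (D u) x = \<mu> * u x powr p)
     \<and> (\<forall>x\<in>{-1<..<1}. u x > 0)
     \<and> u (-1) = 0 \<and> u 1 = 0"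

definition emden_solution :: "real \<Rightarrow> (real \<Rightarrow> real) \<Rightarrow> bool" where
  "emden_solution p W \<longleftrightarrow>
     W \<in> C2_Ibar
     \<and> (\<forall>x\<in>{-1<..<1}. - D (D W) x = W x powr p)
     \<and> (\<forall>x\<in>{-1<..<1}. W x > 0)
     \<and> W (-1) = 0 \<and> W 1 = 0"

(* Requiring W = 0 off [-1,1] selects one representative among the total functions, so that the
   definite description is well defined.
   For c > 0, u = c * W_p solves the Kirchhoff problem iff c powr (1 - p) = mu / (b + a |u'|^2),
   where |u'|^2 = 2 A_p B_p xi^2 with xi = max_norm u. Hence the factor in front of W_p is
   (mu / (b + 2 A_p B_p a xi^2)) powr (1 / (1 - p)); the source prints a square root around
   b + 2 A_p B_p a xi^2, which is a misprint. *)
definition W_sol :: "real \<Rightarrow> real \<Rightarrow> real" where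
  "W_sol p = (THE W. emden_solution p W \<and> (\<forall>x. x \<notin> {-1..1} \<longrightarrow> W x = 0))"

end

theory Submission
  imports Defs
begin

text \<open>
  Let \<open>T(w) = \<integral>\<^sub>0\<^sup>w ds / sqrt (1 - s\<^sup>p\<^sup>+\<^sup>1)\<close>, so that \<open>T(1) = A\<^sub>p\<close>. The profile
  \<open>\<phi>(x) = T\<^sup>-\<^sup>1(A\<^sub>p (1 - |x|))\<close> has maximum \<open>1\<close> and solves
  \<open>-\<phi>'' = (p + 1)/2 A\<^sub>p\<^sup>2 \<phi>\<^sup>p\<close>; as \<open>\<phi>'\<^sup>2 = A\<^sub>p\<^sup>2 (1 - \<phi>\<^sup>p\<^sup>+\<^sup>1)\<close>, the substitution
  \<open>s = \<phi>(x)\<close> gives \<open>\<parallel>\<phi>'\<parallel>\<^sup>2 = 2 A\<^sub>p B\<^sub>p\<close>. Conversely, conservation of energy shows that every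
  positive solution of \<open>-v'' = k v\<^sup>p\<close> with zero boundary values and maximum \<open>m\<close> satisfies
  \<open>T(v(x)/m) = A\<^sub>p - \<kappa> |x - t|\<close> with \<open>\<kappa>\<^sup>2 = 2 k m\<^sup>p\<^sup>-\<^sup>1 / (p + 1)\<close>; the boundary values force
  \<open>t = 0\<close> and \<open>\<kappa> = A\<^sub>p\<close>, so \<open>v = m \<phi>\<close> and \<open>k = (p + 1)/2 A\<^sub>p\<^sup>2 m\<^sup>1\<^sup>-\<^sup>p\<close>. For the Kirchhoff problem
  \<open>k = \<lambda> / (b + a \<parallel>v'\<parallel>\<^sup>2)\<close> with \<open>\<parallel>v'\<parallel>\<^sup>2 = 2 A\<^sub>p B\<^sub>p m\<^sup>2\<close>, so its solutions are the functions \<open>\<xi> \<phi>\<close> with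
  \<open>\<lambda> = \<lambda>(\<xi>)\<close>, and \<open>\<lambda>(\<xi>)\<close> is a bijection of the positive reals because its two exponents
  \<open>3 - p\<close> and \<open>1 - p\<close> have the same sign.
\<close>

subsection \<open>One-sided derivatives on a closed interval\<close>

text \<open>The sign is locally constant away from \<open>c\<close>. This lets the two monotone
  branches on either side of a maximum share one computation.\<close>

lemma DERIV_sgn_mult:
  fixes x c :: real
  assumes "x \<noteq> c" and "(f has_real_derivative d) (at x)"
  shows "((\<lambda>x. sgn (x - c) * f x) has_real_derivative sgn (x - c) * d) (at x)"
proof (cases "x < c")
  case True
  have "((\<lambda>x. - f x) has_real_derivative - d) (at x)"
    using assms(2) by (rule DERIV_minus)
  then have "((\<lambda>x. sgn (x - c) * f x) has_real_derivative - d) (at x)"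
    by (rule has_field_derivative_transform_within_open[of _ _ _ "{..<c}"]) (use True in auto)
  with True show ?thesis by simp
next
  case False
  with assms(1) have "x > c" by simp
  have "((\<lambda>x. sgn (x - c) * f x) has_real_derivative d) (at x)"
    using assms(2)
    by (rule has_field_derivative_transform_within_open[of _ _ _ "{c<..}"]) (use \<open>x > c\<close> in auto)
  with \<open>x > c\<close> show ?thesis by simp
qed

text \<open>The zero of \<open>f\<close> at \<open>c\<close> closes the jump of the sign.\<close>

lemma continuous_on_sgn_mult:
  fixes f :: "real \<Rightarrow> real"
  assumes f: "continuous_on S f" and "f c = 0"
  shows "continuous_on S (\<lambda>x. sgn (x - c) * f x)"
proof -
  have "continuous_on S (\<lambda>x. if x \<le> c then - f x else f x)"
    by (rule continuous_on_cases_le)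
       (auto intro!: continuous_intros continuous_on_subset[OF f] simp: assms)
  also have "(\<lambda>x. if x \<le> c then - f x else f x) = (\<lambda>x. sgn (x - c) * f x)"
    using assms(2) by (auto simp: fun_eq_iff sgn_real_def)
  finally show ?thesis .
qed

text \<open>The exceptional points \<open>S\<close> and the end points are covered because, by the fundamental theorem
  of calculus, \<open>f\<close> is an indefinite integral of the continuous function \<open>g\<close>.\<close>

lemma DERIV_within_of_interior:
  fixes f g :: "real \<Rightarrow> real"
  assumes f: "continuous_on {a..b} f" and g: "continuous_on {a..b} g" and "finite S"
    and der: "\<And>x. x \<in> {a<..<b} - S \<Longrightarrow> (f has_real_derivative g x) (at x)"
    and x: "x \<in> {a..b}"
  shows "(f has_real_derivative g x) (at x within {a..b})"
proof -
  have eq: "f a + integral {a..y} g = f y" if "y \<in> {a..b}" for y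
  proof -
    have "(g has_integral (f y - f a)) {a..y}"
    proof (rule fundamental_theorem_of_calculus_interior_strong[OF \<open>finite S\<close>])
      show "continuous_on {a..y} f"
        by (rule continuous_on_subset[OF f]) (use that in auto)
      show "(f has_vector_derivative g x) (at x)" if "x \<in> {a<..<y} - S" for x
        using der[of x] that \<open>y \<in> {a..b}\<close>
        by (simp add: has_real_derivative_iff_has_vector_derivative)
    qed (use that in auto)
    then show ?thesis by (simp add: integral_unique)
  qed
  have "((\<lambda>y. f a + integral {a..y} g) has_real_derivative 0 + g x) (at x within {a..b})"
    by (rule DERIV_add[OF DERIV_const integral_has_real_derivative[OF g x]])
  then have "((\<lambda>y. f a + integral {a..y} g) has_real_derivative g x) (at x within {a..b})"
    by simp
  then show ?thesis
  proof (rule has_field_derivative_transform_within[where d = 1])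
    show "f a + integral {a..y} g = f y" if "y \<in> {a..b}" for y
      using eq[OF that] .
  qed (rule zero_less_one, rule x)
qed

lemma D_eq:
  assumes "x \<in> {-1..1}" and "(u has_real_derivative d) (at x within {-1..1})"
  shows "D u x = d"
  unfolding D_def
  by (rule vector_derivative_within_closed_interval)
     (use assms in \<open>auto simp: has_real_derivative_iff_has_vector_derivative\<close>)

lemma differentiable_on_imp_DERIV_D:
  assumes "u differentiable_on {-1..1}" and "x \<in> {-1..1}"
  shows "(u has_real_derivative D u x) (at x within {-1..1})"
proof -
  obtain d where "(u has_real_derivative d) (at x within {-1..1})"
    using assms unfolding differentiable_on_def real_differentiable_def by blast
  with assms(2) show ?thesis by (simp add: D_eq)
qed

text \<open>\<open>D u\<close> and \<open>u'\<close> agree only on the interval, but a derivative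
  taken within the interval sees no other values, so \<open>u'\<close> may replace
  \<open>D u\<close> before the second differentiation.\<close>

lemma C2_IbarI:
  assumes 1: "\<And>x. x \<in> {-1..1} \<Longrightarrow> (u has_real_derivative u' x) (at x within {-1..1})"
    and 2: "\<And>x. x \<in> {-1..1} \<Longrightarrow> (u' has_real_derivative u'' x) (at x within {-1..1})"
    and c: "continuous_on {-1..1} u''"
  shows "u \<in> C2_Ibar" and "\<And>x. x \<in> {-1..1} \<Longrightarrow> D u x = u' x"
    and "\<And>x. x \<in> {-1..1} \<Longrightarrow> D (D u) x = u'' x"
proof -
  show D1: "D u x = u' x" if "x \<in> {-1..1}" for x
    using D_eq 1 that by blast
  have der2: "(D u has_real_derivative u'' x) (at x within {-1..1})" if "x \<in> {-1..1}" for x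
    by (rule has_field_derivative_transform_within[OF 2[OF that], of 1]) (use that D1 in auto)
  show D2: "D (D u) x = u'' x" if "x \<in> {-1..1}" for x
    using D_eq der2 that by blast
  have "continuous_on {-1..1} (D (D u)) \<longleftrightarrow> continuous_on {-1..1} u''"
    by (rule continuous_on_cong[OF refl D2])
  moreover have "u differentiable_on {-1..1}" "D u differentiable_on {-1..1}"
    using 1 der2 unfolding differentiable_on_def real_differentiable_def by blast+
  ultimately show "u \<in> C2_Ibar"
    using c by (simp add: C2_Ibar_def)
qed

lemma continuous_on_powr_nonneg:
  assumes "continuous_on S f" and "\<And>x. x \<in> S \<Longrightarrow> 0 \<le> f x" and "q > 0"
  shows "continuous_on S (\<lambda>x. f x powr q :: real)"
  by (rule continuous_on_powr') (use assms in \<open>auto intro: continuous_intros\<close>)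

text \<open>Rolle's theorem gives a critical point \<open>t\<close>; since \<open>v'\<close> is
  strictly decreasing, it changes sign exactly there. This later fixes the sign of the square root
  in the energy identity.\<close>

lemma positive_solution_slope_sign:
  assumes der1: "\<And>x. x \<in> {-1..1} \<Longrightarrow> (v has_real_derivative v' x) (at x within {-1..1})"
    and der2: "\<And>x. x \<in> {-1..1} \<Longrightarrow> (v' has_real_derivative v'' x) (at x within {-1..1})"
    and neg: "\<And>x. x \<in> {-1<..<1} \<Longrightarrow> v'' x < 0"
    and ends: "v (-1) = v 1"
  obtains t where "t \<in> {-1<..<1}" "v' t = 0"
    "\<And>x. x \<in> {-1..1} \<Longrightarrow> sgn (v' x) = - sgn (x - t)"
proof -
  have at: "(v has_real_derivative v' x) (at x)" "(v' has_real_derivative v'' x) (at x)"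
    if "x \<in> {-1<..<1}" for x
    using der1[of x] der2[of x] that at_within_Icc_at[of "-1" x 1] by auto
  have cont: "continuous_on {-1..1} v" "continuous_on {-1..1} v'"
    using der1 der2 by (meson DERIV_continuous_on)+
  obtain t where t: "-1 < t" "t < 1" "(v has_real_derivative 0) (at t)"
    using Rolle[of "-1" 1 v] ends cont(1) at(1) unfolding real_differentiable_def by force
  have t0: "v' t = 0" using DERIV_unique[OF at(1) t(3)] t by simp
  have dec: "v' y < v' x" if "-1 \<le> x" "x < y" "y \<le> 1" for x y
  proof (rule DERIV_neg_imp_decreasing_open[OF \<open>x < y\<close>])
    show "\<exists>d. (v' has_real_derivative d) (at z) \<and> d < 0" if "x < z" "z < y" for z
      using at(2)[of z] neg[of z] that \<open>-1 \<le> x\<close> \<open>y \<le> 1\<close> by auto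
    show "continuous_on {x..y} v'"
      by (rule continuous_on_subset[OF cont(2)]) (use that in auto)
  qed
  have "sgn (v' x) = - sgn (x - t)" if "x \<in> {-1..1}" for x
    using dec[of x t] dec[of t x] that t t0 by (cases x t rule: linorder_cases) auto
  with that t t0 show ?thesis by auto
qed

subsection \<open>The time map and the normalized profile\<close>

text \<open>The time map of the phase-plane method: separating variables in the energy identity of a
  solution of height 1 makes the distance travelled in \<open>x\<close> proportional to this
  integral.\<close>

definition time_map :: "real \<Rightarrow> real \<Rightarrow> real" where
  "time_map p w = integral {0..w} (\<lambda>s. 1 / sqrt (1 - s powr (p + 1)))"

text \<open>Composed with the profile, this is on each side of 0, up to sign and the factor
  \<open>A_const p\<close>, an antiderivative of the squared slope.\<close>

definition area_map :: "real \<Rightarrow> real \<Rightarrow> real" where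
  "area_map p w = integral {0..w} (\<lambda>s. sqrt (1 - s powr (p + 1)))"

text \<open>The value 0 off the interval matches the representative selected by
  \<open>W_sol\<close>.\<close>

definition profile :: "real \<Rightarrow> real \<Rightarrow> real" where
  "profile p x = (if x \<in> {-1..1} then inv_into {0..1} (time_map p) (A_const p * (1 - \<bar>x\<bar>)) else 0)"

definition kirchhoff_parameter :: "real \<Rightarrow> real \<Rightarrow> real \<Rightarrow> real \<Rightarrow> real" where
  "kirchhoff_parameter p a b \<xi> = (p + 1) / 2 * (A_const p)\<^sup>2
     * (2 * A_const p * B_const p * a * \<xi> powr (3 - p) + b * \<xi> powr (1 - p))"

lemma time_map_0 [simp]: "time_map p 0 = 0" and time_map_1 [simp]: "time_map p 1 = A_const p"
  by (simp_all add: time_map_def A_const_def)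

lemma area_map_0 [simp]: "area_map p 0 = 0" and area_map_1 [simp]: "area_map p 1 = B_const p"
  by (simp_all add: area_map_def B_const_def)

context
  fixes p :: real
  assumes p: "p > 0"
begin

section \<open>Analytic properties of the time map and the area map\<close>

lemma powr_Suc_le: "s powr (p + 1) \<le> s" if "0 \<le> s" "s \<le> 1" for s :: real
  using that p powr_mono'[of 1 "p + 1" s] by (cases "s = 0") auto

lemma powr_Suc_less_1: "s powr (p + 1) < 1" if "0 \<le> s" "s < 1" for s :: real
  using powr_Suc_le[of s] that by linarith

text \<open>The singularity at 1 is dominated by that of \<open>1 / sqrt (1 - s)\<close>, which has
  the antiderivative \<open>- 2 * sqrt (1 - s)\<close>, continuous up to 1.\<close>

lemma integrable_time_map_integrand: "(\<lambda>s. 1 / sqrt (1 - s powr (p + 1))) integrable_on {0..1}"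
proof (rule measurable_bounded_by_integrable_imp_integrable_real)
  show "(\<lambda>s. 1 / sqrt (1 - s powr (p + 1))) \<in> borel_measurable (lebesgue_on {0..1})"
  proof (rule measurable_restrict_space1)
    show "(\<lambda>s. 1 / sqrt (1 - s powr (p + 1))) \<in> borel_measurable lebesgue"
      by (rule measurable_completion) measurable
  qed
  have "((\<lambda>s. 1 / sqrt (1 - s)) has_integral (- 2 * sqrt (1 - 1) - - 2 * sqrt (1 - 0))) {0..1::real}"
    by (rule fundamental_theorem_of_calculus_interior)
       (auto intro!: continuous_intros derivative_eq_intros
         simp: has_real_derivative_iff_has_vector_derivative[symmetric] field_simps)
  then show "(\<lambda>s. 1 / sqrt (1 - s)) integrable_on {0..1::real}" by blast
  show "\<bar>1 / sqrt (1 - s powr (p + 1))\<bar> \<le> 1 / sqrt (1 - s)" if "s \<in> {0..1}" for s :: real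
  \<comment> \<open>At \<open>s = 1\<close> both quotients are \<open>1 / 0\<close>, which equals
    0.\<close>
  proof (cases "s = 1")
    case False
    with that powr_Suc_le[of s] show ?thesis
      by (auto intro!: divide_left_mono)
  qed simp
qed simp

lemma continuous_on_time_map: "continuous_on {0..1} (time_map p)"
  unfolding time_map_def by (rule indefinite_integral_continuous_1[OF integrable_time_map_integrand])

lemma continuous_on_area_map_integrand: "continuous_on {0..1} (\<lambda>s. sqrt (1 - s powr (p + 1)))"
  by (intro continuous_intros continuous_on_powr_nonneg) (use p in auto)

lemma continuous_on_area_map: "continuous_on {0..1} (area_map p)"
  unfolding area_map_def
  by (rule indefinite_integral_continuous_1[OF
        integrable_continuous_real[OF continuous_on_area_map_integrand]])

lemma DERIV_time_map:
  assumes "w \<in> {0<..<1}"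
  shows "(time_map p has_real_derivative 1 / sqrt (1 - w powr (p + 1))) (at w)"
proof -
  have "continuous (at w within {0..1} - {}) (\<lambda>s. 1 / sqrt (1 - s powr (p + 1)))"
    using assms powr_Suc_less_1[of w] by (intro continuous_intros) auto
  from integral_has_vector_derivative_continuous_at[OF integrable_time_map_integrand _ _ this]
  have "(time_map p has_real_derivative 1 / sqrt (1 - w powr (p + 1))) (at w within {0..1})"
    using assms by (simp add: has_real_derivative_iff_has_vector_derivative time_map_def[abs_def])
  then show ?thesis
    using assms at_within_Icc_at[of 0 w 1] by simp
qed

lemma DERIV_area_map:
  assumes "w \<in> {0<..<1}"
  shows "(area_map p has_real_derivative sqrt (1 - w powr (p + 1))) (at w)"
proof -
  have "(area_map p has_real_derivative sqrt (1 - w powr (p + 1))) (at w within {0..1})"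
    using integral_has_real_derivative[OF continuous_on_area_map_integrand, of w] assms
    by (simp add: area_map_def[abs_def])
  then show ?thesis
    using assms at_within_Icc_at[of 0 w 1] by simp
qed

lemma strict_mono_on_time_map: "strict_mono_on {0..1} (time_map p)"
proof (rule strict_mono_onI)
  fix v w :: real assume vw: "v \<in> {0..1}" "w \<in> {0..1}" "v < w"
  show "time_map p v < time_map p w"
  proof (rule DERIV_pos_imp_increasing_open[OF \<open>v < w\<close>])
    show "\<exists>y. (time_map p has_real_derivative y) (at x) \<and> 0 < y" if "v < x" "x < w" for x
      using that vw DERIV_time_map[of x] powr_Suc_less_1[of x] by fastforce
  qed (use vw in \<open>auto intro!: continuous_on_subset[OF continuous_on_time_map]\<close>)
qed

lemma A_const_pos: "A_const p > 0"
  using strict_mono_onD[OF strict_mono_on_time_map, of 0 1] by simp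

lemma B_const_pos: "B_const p > 0"
proof -
  have "area_map p 0 < area_map p 1"
  proof (rule DERIV_pos_imp_increasing_open[of 0 1 "area_map p"])
    show "\<exists>y. (area_map p has_real_derivative y) (at x) \<and> 0 < y" if "0 < x" "x < 1" for x
      using that DERIV_area_map[of x] powr_Suc_less_1[of x] by fastforce
  qed (use continuous_on_area_map in auto)
  then show ?thesis by simp
qed

lemma inj_on_time_map: "inj_on (time_map p) {0..1}"
  by (rule strict_mono_on_imp_inj_on[OF strict_mono_on_time_map])

lemma time_map_image: "time_map p ` {0..1} = {0..A_const p}"
proof (intro equalityI subsetI)
  fix y assume "y \<in> time_map p ` {0..1}"
  then obtain w where w: "w \<in> {0..1}" "y = time_map p w" by blast
  have "mono_on {0..1} (time_map p)"
    by (rule strict_mono_on_imp_mono_on[OF strict_mono_on_time_map])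
  from mono_onD[OF this, of 0 w] mono_onD[OF this, of w 1] w
  show "y \<in> {0..A_const p}" by simp
next
  fix y assume "y \<in> {0..A_const p}"
  then obtain w where "0 \<le> w" "w \<le> 1" "time_map p w = y"
    using IVT'[of "time_map p" 0 y 1] continuous_on_time_map by auto
  then show "y \<in> time_map p ` {0..1}" by auto
qed

section \<open>The normalized profile as an inverse of the time map\<close>

lemma profile_arg_in_image: "A_const p * (1 - \<bar>x\<bar>) \<in> time_map p ` {0..1}" if "x \<in> {-1..1}"
proof -
  have "0 \<le> 1 - \<bar>x\<bar>" "1 - \<bar>x\<bar> \<le> 1" using that by auto
  then show ?thesis
    using A_const_pos by (simp add: time_map_image mult_left_le)
qed

lemma profile_range: "profile p x \<in> {0..1}" if "x \<in> {-1..1}"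
  using inv_into_into[OF profile_arg_in_image[OF that]] that by (simp add: profile_def)

lemma time_map_profile: "time_map p (profile p x) = A_const p * (1 - \<bar>x\<bar>)" if "x \<in> {-1..1}"
  using f_inv_into_f[OF profile_arg_in_image[OF that]] that by (simp add: profile_def)

lemma profile_eqI:
  assumes "x \<in> {-1..1}" "w \<in> {0..1}" "time_map p w = A_const p * (1 - \<bar>x\<bar>)"
  shows "profile p x = w"
  using inj_onD[OF inj_on_time_map, of "profile p x" w] assms
    profile_range time_map_profile by metis

lemma profile_values [simp]: "profile p (-1) = 0" "profile p 1 = 0" "profile p 0 = 1"
  by (rule profile_eqI; simp)+

lemma profile_pos: "profile p x > 0" if "x \<in> {-1<..<1}"
proof -
  have "time_map p (profile p x) > 0"
    using time_map_profile[of x] that A_const_pos by auto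
  then have "profile p x \<noteq> 0" by auto
  with profile_range[of x] that show ?thesis by auto
qed

lemma profile_less_1: "profile p x < 1" if "x \<in> {-1..1}" "x \<noteq> 0"
proof -
  have "time_map p (profile p x) \<noteq> A_const p"
    using time_map_profile[of x] that A_const_pos by auto
  then have "profile p x \<noteq> 1" by auto
  with profile_range[of x] that show ?thesis by auto
qed

lemma continuous_on_inv_time_map:
  "continuous_on {0..A_const p} (inv_into {0..1} (time_map p))"
  using continuous_on_inv[OF continuous_on_time_map, of "inv_into {0..1} (time_map p)"]
    inj_on_time_map by (simp add: time_map_image)

lemma continuous_on_profile: "continuous_on {-1..1} (profile p)"
proof -
  have "continuous_on {-1..1} (\<lambda>x. inv_into {0..1} (time_map p) (A_const p * (1 - \<bar>x\<bar>)))"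
    by (rule continuous_on_compose2[OF continuous_on_inv_time_map])
       (use profile_arg_in_image time_map_image in \<open>auto intro!: continuous_intros\<close>)
  then show ?thesis
    by (rule continuous_on_eq) (simp add: profile_def)
qed

text \<open>Inverse function rule for the time map. The point 0 is left out because the profile has
  the value 1 there, where the integrand of the time map is singular.\<close>

lemma DERIV_profile:
  assumes x: "x \<in> {-1<..<1}" "x \<noteq> 0"
  shows "(profile p has_real_derivative
    - (A_const p * (sgn x * sqrt (1 - profile p x powr (p + 1))))) (at x)"
proof -
  let ?h = "inv_into {0..1} (time_map p)" and ?y = "A_const p * (1 - \<bar>x\<bar>)"
  have hy: "?h ?y = profile p x" using x by (simp add: profile_def)
  have w: "profile p x \<in> {0<..<1}" using x profile_pos profile_less_1 by simp
  have y: "0 < ?y" "?y < A_const p" using x A_const_pos by auto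
  have "(?h has_real_derivative inverse (1 / sqrt (1 - profile p x powr (p + 1)))) (at ?y)"
  proof (rule DERIV_inverse_function[where f = "time_map p", OF _ _ y])
    show "(time_map p has_real_derivative 1 / sqrt (1 - profile p x powr (p + 1))) (at (?h ?y))"
      using DERIV_time_map[OF w] hy by simp
    show "1 / sqrt (1 - profile p x powr (p + 1)) \<noteq> 0"
      using powr_Suc_less_1[of "profile p x"] p w by simp
    show "time_map p (?h z) = z" if "0 < z" "z < A_const p" for z
      using that by (intro f_inv_into_f) (simp add: time_map_image)
    show "isCont ?h ?y"
      using continuous_on_interior[OF continuous_on_inv_time_map] y by simp
  qed
  then have dh: "(?h has_real_derivative sqrt (1 - profile p x powr (p + 1))) (at ?y)" by simp
  have "((\<lambda>x. sgn (x - 0) * x) has_real_derivative sgn (x - 0) * 1) (at x)"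
    by (rule DERIV_sgn_mult[OF x(2) DERIV_ident])
  from DERIV_cmult[OF DERIV_diff[OF DERIV_const this], of "A_const p" 1]
  have "((\<lambda>x. A_const p * (1 - sgn x * x)) has_real_derivative - (A_const p * sgn x)) (at x)"
    by simp
  then have "((\<lambda>x. A_const p * (1 - \<bar>x\<bar>)) has_real_derivative - (A_const p * sgn x)) (at x)"
    by (simp only: abs_sgn mult.commute)
  from DERIV_chain2[OF dh this]
  have "((\<lambda>x. ?h (A_const p * (1 - \<bar>x\<bar>))) has_real_derivative
    - (A_const p * (sgn x * sqrt (1 - profile p x powr (p + 1))))) (at x)"
    by (simp add: mult_ac)
  then show ?thesis
    by (rule has_field_derivative_transform_within_open[where S = "{-1<..<1}"])
       (use x in \<open>auto simp: profile_def\<close>)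
qed

text \<open>Differentiating the root produces its reciprocal, which cancels against the root in the
  slope of the profile; hence the second derivative extends continuously to 0.\<close>

lemma DERIV_profile_slope:
  assumes x: "x \<in> {-1<..<1}" "x \<noteq> 0"
  shows "((\<lambda>x. - (A_const p * (sgn x * sqrt (1 - profile p x powr (p + 1)))))
    has_real_derivative - ((p + 1) / 2 * (A_const p)\<^sup>2 * profile p x powr p)) (at x)"
proof -
  let ?r = "sqrt (1 - profile p x powr (p + 1))"
  have w: "0 < profile p x" "profile p x < 1" using x profile_pos profile_less_1 by simp_all
  then have less: "profile p x powr (p + 1) < 1" using powr_Suc_less_1 by simp
  then have r: "?r > 0" by simp
  have "((\<lambda>x. profile p x powr (p + 1)) has_real_derivative
      (p + 1) * profile p x powr p * (- (A_const p * (sgn x * ?r)))) (at x)"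
    using DERIV_chain2[OF has_real_derivative_powr[OF w(1), of "p + 1"] DERIV_profile[OF x]]
    p by simp
  from DERIV_chain2[OF DERIV_real_sqrt, OF _ DERIV_diff[OF DERIV_const this], of 1] less
  have "((\<lambda>x. sqrt (1 - profile p x powr (p + 1))) has_real_derivative
      inverse ?r / 2 * (0 - (p + 1) * profile p x powr p * (- (A_const p * (sgn x * ?r))))) (at x)"
    by simp
  also have "inverse ?r / 2 * (0 - (p + 1) * profile p x powr p * (- (A_const p * (sgn x * ?r))))
      = (p + 1) / 2 * A_const p * profile p x powr p * sgn x"
    using r by (simp add: field_simps)
  finally have "((\<lambda>x. sqrt (1 - profile p x powr (p + 1))) has_real_derivative
      (p + 1) / 2 * A_const p * profile p x powr p * sgn x) (at x)" .
  from DERIV_minus[OF DERIV_cmult[OF DERIV_sgn_mult[OF x(2) this], of "A_const p"]]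
  show ?thesis
    \<comment> \<open>The two signs, from the slope and from its derivative, multiply to 1 because
      \<open>x \<noteq> 0\<close>.\<close>
    by (simp add: power2_eq_square mult_ac) (use x in \<open>simp add: sgn_real_def split: if_splits\<close>)
qed

lemma continuous_on_profile_slope:
  "continuous_on {-1..1} (\<lambda>x. - (A_const p * (sgn x * sqrt (1 - profile p x powr (p + 1)))))"
proof -
  have "continuous_on {-1..1} (\<lambda>x. sqrt (1 - profile p x powr (p + 1)))"
    using profile_range p
    by (intro continuous_intros continuous_on_powr_nonneg continuous_on_profile) auto
  from continuous_on_sgn_mult[OF this, of 0] show ?thesis
    by (auto intro!: continuous_intros)
qed

lemma profile_derivs:
  assumes x: "x \<in> {-1..1}"
  shows "(profile p has_real_derivative
      - (A_const p * (sgn x * sqrt (1 - profile p x powr (p + 1))))) (at x within {-1..1})"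
    and "((\<lambda>x. - (A_const p * (sgn x * sqrt (1 - profile p x powr (p + 1)))))
      has_real_derivative - ((p + 1) / 2 * (A_const p)\<^sup>2 * profile p x powr p))
      (at x within {-1..1})"
    and "continuous_on {-1..1} (\<lambda>x. - ((p + 1) / 2 * (A_const p)\<^sup>2 * profile p x powr p))"
proof -
  show c: "continuous_on {-1..1} (\<lambda>x. - ((p + 1) / 2 * (A_const p)\<^sup>2 * profile p x powr p))"
    using profile_range p
    by (intro continuous_intros continuous_on_powr_nonneg continuous_on_profile) auto
  show "(profile p has_real_derivative
      - (A_const p * (sgn x * sqrt (1 - profile p x powr (p + 1))))) (at x within {-1..1})"
    by (rule DERIV_within_of_interior[OF continuous_on_profile continuous_on_profile_slope,
          of "{0}", OF _ _ x]) (use DERIV_profile in auto)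
  show "((\<lambda>x. - (A_const p * (sgn x * sqrt (1 - profile p x powr (p + 1)))))
      has_real_derivative - ((p + 1) / 2 * (A_const p)\<^sup>2 * profile p x powr p))
      (at x within {-1..1})"
    by (rule DERIV_within_of_interior[OF continuous_on_profile_slope c, of "{0}", OF _ _ x])
       (use DERIV_profile_slope in auto)
qed

text \<open>The substitution \<open>s = profile p x\<close> is carried out by an explicit
  antiderivative on both halves at once.\<close>

lemma integral_profile_slope_squared:
  "integral {-1<..<1} (\<lambda>x. (A_const p * (sgn x * sqrt (1 - profile p x powr (p + 1))))\<^sup>2)
    = 2 * A_const p * B_const p"
proof -
  let ?s = "\<lambda>x. A_const p * (sgn x * sqrt (1 - profile p x powr (p + 1)))"
  \<comment> \<open>Subtracting from \<open>B_const p\<close> makes the bracket vanish at 0, so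
    \<open>?H\<close> is continuous there; its values at 1 and -1 are plus and minus
    \<open>A_const p * B_const p\<close>.\<close>
  let ?H = "\<lambda>x. A_const p * (sgn x * (B_const p - area_map p (profile p x)))"
  have "((\<lambda>x. (?s x)\<^sup>2) has_integral (?H 1 - ?H (-1))) {-1..1}"
  proof (rule fundamental_theorem_of_calculus_interior_strong[of "{0}"])
    have "continuous_on {-1..1} (\<lambda>x. B_const p - area_map p (profile p x))"
      using profile_range
      by (intro continuous_intros continuous_on_compose2[OF continuous_on_area_map]
          continuous_on_profile) auto
    from continuous_on_sgn_mult[OF this, of 0]
    show "continuous_on {-1..1} ?H" by (auto intro!: continuous_intros)
    fix x :: real assume "x \<in> {-1<..<1} - {0}"
    then have x: "x \<in> {-1<..<1}" "x \<noteq> 0" by auto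
    then have w: "profile p x \<in> {0<..<1}" using profile_pos profile_less_1 by simp
    from DERIV_chain2[OF DERIV_area_map[OF w] DERIV_profile[OF x]]
    have "((\<lambda>x. area_map p (profile p x)) has_real_derivative
      sqrt (1 - profile p x powr (p + 1)) * - ?s x) (at x)" .
    from DERIV_cmult[OF DERIV_sgn_mult[OF x(2) DERIV_diff[OF DERIV_const this]]]
    have "(?H has_real_derivative
        A_const p * (sgn x * (0 - sqrt (1 - profile p x powr (p + 1)) * - ?s x))) (at x)"
      by simp
    also have "A_const p * (sgn x * (0 - sqrt (1 - profile p x powr (p + 1)) * - ?s x)) = (?s x)\<^sup>2"
      by (simp add: power2_eq_square mult_ac)
    finally show "(?H has_vector_derivative (?s x)\<^sup>2) (at x)"
      by (simp add: has_real_derivative_iff_has_vector_derivative)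
  qed auto
  then have "integral {-1..1} (\<lambda>x. (?s x)\<^sup>2) = 2 * A_const p * B_const p"
    by (simp add: integral_unique)
  then show ?thesis by (simp add: integral_open_interval_real)
qed

section \<open>Classification of positive solutions with constant coefficient\<close>

lemma positive_solution_eq_profile:
  assumes C2: "v \<in> C2_Ibar" and k: "k > 0"
    and eq: "\<And>x. x \<in> {-1<..<1} \<Longrightarrow> D (D v) x = - (k * v x powr p)"
    and pos: "\<And>x. x \<in> {-1<..<1} \<Longrightarrow> v x > 0" and ends: "v (-1) = 0" "v 1 = 0"
  obtains m where "m > 0" "k = (p + 1) / 2 * (A_const p)\<^sup>2 * m powr (1 - p)"
    "\<And>x. x \<in> {-1..1} \<Longrightarrow> v x = m * profile p x"
proof -
  have der1: "(v has_real_derivative D v x) (at x within {-1..1})"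
    and der2: "(D v has_real_derivative D (D v) x) (at x within {-1..1})" if "x \<in> {-1..1}" for x
    using C2 that differentiable_on_imp_DERIV_D unfolding C2_Ibar_def by auto
  have at: "(v has_real_derivative D v x) (at x)" "(D v has_real_derivative D (D v) x) (at x)"
    if "x \<in> {-1<..<1}" for x
    using der1[of x] der2[of x] that at_within_Icc_at[of "-1" x 1] by auto
  have cont: "continuous_on {-1..1} v" "continuous_on {-1..1} (D v)"
    using der1 der2 by (meson DERIV_continuous_on)+
  have neg: "D (D v) x < 0" if "x \<in> {-1<..<1}" for x
    using eq[OF that] pos[OF that] k by simp
  have ends_eq: "v (-1) = v 1" using ends by simp
  obtain t where t: "t \<in> {-1<..<1}" "D v t = 0"
    and sgn: "\<And>x. x \<in> {-1..1} \<Longrightarrow> sgn (D v x) = - sgn (x - t)"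
    using positive_solution_slope_sign[OF der1 der2 neg ends_eq] by blast
  have nonneg: "v x \<ge> 0" if "x \<in> {-1..1}" for x
    using pos[of x] ends that by (cases "x = -1 \<or> x = 1") auto
  define m where "m = v t"
  have m: "m > 0" using pos t by (simp add: m_def)
  let ?c = "2 * k / (p + 1)"
  \<comment> \<open>The rate at which the time map of \<open>v / m\<close> changes along the
    solution.\<close>
  define \<kappa> where "\<kappa> = sqrt (?c * m powr (p - 1))"
  have \<kappa>: "\<kappa> > 0" and \<kappa>2: "\<kappa>\<^sup>2 = ?c * m powr (p - 1)"
    using k p m by (simp_all add: \<kappa>_def)
  have "m powr (p + 1) = m powr (p - 1) * m\<^sup>2"
    using m by (simp add: add.commute flip: powr_numeral powr_add)
  then have \<kappa>m: "?c * m powr (p + 1) = (\<kappa> * m)\<^sup>2"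
    by (simp add: power_mult_distrib \<kappa>2)
  \<comment> \<open>The first integral: its derivative is
    \<open>2 * D v x * (D (D v) x + k * v x powr p)\<close>, which vanishes by the equation.\<close>
  define E where "E x = (D v x)\<^sup>2 + ?c * v x powr (p + 1)" for x
  have E: "E x = E (-1)" if "x \<in> {-1..1}" for x
  proof (rule DERIV_isconst2[of "-1" 1])
    show "continuous_on {-1..1} E"
      unfolding E_def using nonneg p
      by (intro continuous_intros continuous_on_powr_nonneg cont) auto
    fix y :: real assume "-1 < y" "y < 1"
    then have y: "y \<in> {-1<..<1}" by simp
    have "((\<lambda>x. v x powr (p + 1)) has_real_derivative (p + 1) * v y powr p * D v y) (at y)"
      using DERIV_chain2[OF has_real_derivative_powr[OF pos[OF y], of "p + 1"] at(1)[OF y]]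
      by simp
    from DERIV_add[OF DERIV_power[OF at(2)[OF y], of 2] DERIV_cmult[OF this, of ?c]]
    show "(E has_real_derivative 0) (at y)"
      using p by (simp add: E_def[abs_def] eq[OF y] field_simps)
  qed (use that in auto)
  define s where "s x = v x / m" for x
  have energy: "(D v x)\<^sup>2 = (\<kappa> * m)\<^sup>2 * (1 - s x powr (p + 1))" if "x \<in> {-1..1}" for x
  proof -
    \<comment> \<open>Comparison with the maximum point, where the slope vanishes and only the
      potential term remains.\<close>
    have "E x = E t" using E[OF that] E[of t] t by simp
    then have "(D v x)\<^sup>2 = ?c * m powr (p + 1) - ?c * v x powr (p + 1)"
      by (simp add: E_def t m_def)
    also have "v x powr (p + 1) = m powr (p + 1) * s x powr (p + 1)"
      using m nonneg[OF that] by (simp add: s_def flip: powr_mult)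
    finally show ?thesis by (simp only: \<kappa>m[symmetric] right_diff_distrib mult_1_right mult.assoc)
  qed
  have s_nonneg: "0 \<le> s x" if "x \<in> {-1..1}" for x
    using nonneg[OF that] m by (simp add: s_def)
  have s_less: "s x < 1" if "x \<in> {-1..1}" "x \<noteq> t" for x
  proof (rule ccontr)
    assume "\<not> s x < 1"
    \<comment> \<open>Reaching height \<open>m\<close> again would leave no kinetic energy, hence
      zero slope, but the slope vanishes only at \<open>t\<close>.\<close>
    then have "s x powr (p + 1) \<ge> 1" using p by (simp add: ge_one_powr_ge_zero)
    then have "(D v x)\<^sup>2 \<le> 0"
      using energy[OF that(1)] by (simp add: mult_nonneg_nonpos)
    then have "sgn (D v x) = 0" by simp
    with sgn[OF that(1)] that(2) show False by (simp add: sgn_zero_iff)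
  qed
  have s_t: "s t = 1" using m by (simp add: s_def m_def)
  have s_le: "s x \<le> 1" if "x \<in> {-1..1}" for x
    using s_less[OF that] s_t by (cases "x = t") auto
  \<comment> \<open>The energy identity gives the modulus of the slope, the strict concavity its
    sign.\<close>
  have slope: "D v x = - (sgn (x - t) * (\<kappa> * m * sqrt (1 - s x powr (p + 1))))" if "x \<in> {-1..1}" for x
  proof -
    have "\<bar>D v x\<bar> = sqrt ((\<kappa> * m)\<^sup>2 * (1 - s x powr (p + 1)))"
      using energy[OF that] by (metis real_sqrt_abs)
    also have "\<dots> = \<kappa> * m * sqrt (1 - s x powr (p + 1))"
      using \<kappa> m by (simp add: real_sqrt_mult)
    finally show ?thesis
      using sgn[OF that] sgn_mult_abs[of "D v x"] by simp
  qed
  \<comment> \<open>\<open>F\<close> is constant although it need not be differentiable at the maximum point \<open>t\<close>.\<close>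
  define F where "F x = time_map p (s x) + \<kappa> * \<bar>x - t\<bar>" for x
  have F_cont: "continuous_on {-1..1} F"
    unfolding F_def s_def using s_nonneg s_le m
    by (intro continuous_intros continuous_on_compose2[OF continuous_on_time_map] cont)
       (auto simp: s_def)
  have F: "F x = F (-1)" if "x \<in> {-1..1}" for x
  proof -
    have F_within: "(F has_real_derivative 0) (at y within {-1..1})" if "y \<in> {-1..1}" for y
    proof (rule DERIV_within_of_interior[OF F_cont _ _ _ that, of "\<lambda>_. 0" "{t}"])
      fix x assume "x \<in> {-1<..<1} - {t}"
      then have x: "x \<in> {-1<..<1}" "x \<in> {-1..1}" "x \<noteq> t" by auto
      have sx: "s x \<in> {0<..<1}" using pos[OF x(1)] m s_less[OF x(2,3)] by (simp add: s_def)
      then have r: "sqrt (1 - s x powr (p + 1)) > 0" using powr_Suc_less_1[of "s x"] by simp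
      have "(s has_real_derivative D v x / m) (at x)"
        unfolding s_def by (rule DERIV_cdivide[OF at(1)[OF x(1)]])
      from DERIV_chain2[OF DERIV_time_map[OF sx] this]
      have "((\<lambda>x. time_map p (s x)) has_real_derivative - (\<kappa> * sgn (x - t))) (at x)"
        using r m by (simp add: slope[OF x(2)] field_simps)
      moreover have "((\<lambda>x. \<bar>x - t\<bar>) has_real_derivative sgn (x - t)) (at x)"
        using DERIV_sgn_mult[OF x(3) DERIV_diff[OF DERIV_ident DERIV_const[of t]]]
        by (simp add: abs_sgn mult.commute)
      ultimately have "(F has_real_derivative - (\<kappa> * sgn (x - t)) + \<kappa> * sgn (x - t)) (at x)"
        unfolding F_def by (intro DERIV_add DERIV_cmult)
      then show "(F has_real_derivative 0) (at x)" by simp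
    qed auto
    have "(F has_real_derivative 0) (at y)" if "-1 < y" "y < 1" for y
      using F_within[of y] that at_within_Icc_at[of "-1" y 1] by simp
    then show ?thesis
      using DERIV_isconst2[of "-1" 1 F x, OF _ F_cont] that by simp
  qed
  have F_A: "time_map p (s x) + \<kappa> * \<bar>x - t\<bar> = A_const p" if "x \<in> {-1..1}" for x
  proof -
    \<comment> \<open>At \<open>t\<close> the normalized height is 1, so the constant is
      \<open>time_map p 1 = A_const p\<close>.\<close>
    have "F x = F t" using F[OF that] F[of t] t by simp
    then show ?thesis by (simp add: F_def s_t)
  qed
  \<comment> \<open>The time map vanishes at both ends; equal travel times on the two sides of
    \<open>t\<close> force \<open>t\<close> to be the midpoint.\<close>
  have "\<kappa> * (1 + t) = A_const p" "\<kappa> * (1 - t) = A_const p"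
    using F_A[of "-1"] F_A[of 1] t by (simp_all add: s_def ends abs_if add.commute)
  then have "\<kappa> * t = 0" "\<kappa> = A_const p"
    unfolding distrib_left right_diff_distrib by linarith+
  then have t0: "t = 0" and \<kappa>A: "\<kappa> = A_const p" using \<kappa> by simp_all
  have "(A_const p)\<^sup>2 * m powr (1 - p) = ?c * (m powr (p - 1) * m powr (1 - p))"
    using \<kappa>2 \<kappa>A by simp
  also have "m powr (p - 1) * m powr (1 - p) = 1"
    using m by (simp flip: powr_add)
  finally have "k = (p + 1) / 2 * (A_const p)\<^sup>2 * m powr (1 - p)"
    using p by (simp add: field_simps)
  moreover have "v x = m * profile p x" if x: "x \<in> {-1..1}" for x
  proof -
    have "profile p x = s x"
      using F_A[OF x] s_nonneg[OF x] s_le[OF x] x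
      by (intro profile_eqI) (simp_all add: \<kappa>A t0 algebra_simps)
    then show ?thesis using m by (simp add: s_def)
  qed
  ultimately show ?thesis using that m by blast
qed

text \<open>Converse of the classification. Since \<open>v\<close> is prescribed only on the closed
  interval, derivatives are transferred from the profile within that interval.\<close>

lemma scaled_profile:
  assumes \<xi>: "\<xi> > 0" and v: "\<forall>x\<in>{-1..1}. v x = \<xi> * profile p x"
  shows "v \<in> C2_Ibar"
    and "(L2_norm_I (D v))\<^sup>2 = 2 * A_const p * B_const p * \<xi>\<^sup>2"
    and "\<And>x. x \<in> {-1<..<1} \<Longrightarrow>
      - D (D v) x = (p + 1) / 2 * (A_const p)\<^sup>2 * \<xi> powr (1 - p) * v x powr p"
    and "\<And>x. x \<in> {-1<..<1} \<Longrightarrow> v x > 0"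
    and "v (-1) = 0" "v 1 = 0"
    and "max_norm v = \<xi>"
proof -
  let ?s = "\<lambda>x. A_const p * (sgn x * sqrt (1 - profile p x powr (p + 1)))"
  note v = v[rule_format]
  let ?d = "\<lambda>x. \<xi> * - ((p + 1) / 2 * (A_const p)\<^sup>2 * profile p x powr p)"
  have 1: "(v has_real_derivative \<xi> * - ?s x) (at x within {-1..1})" if "x \<in> {-1..1}" for x
    by (rule has_field_derivative_transform_within[OF DERIV_cmult[OF profile_derivs(1)[OF that]], of 1])
       (use that v in auto)
  have 2: "((\<lambda>x. \<xi> * - ?s x) has_real_derivative ?d x) (at x within {-1..1})" if "x \<in> {-1..1}" for x
    by (rule DERIV_cmult[OF profile_derivs(2)[OF that]])
  have "continuous_on {-1..1} ?d"
    \<comment> \<open>The continuity fact does not depend on the point, so any point of the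
      interval, here 0, serves to instantiate it.\<close>
    by (rule continuous_on_mult_left[OF profile_derivs(3)[of 0]]) simp
  note C2 = C2_IbarI[of v, OF 1 2 this, simplified]
  show "v \<in> C2_Ibar" using C2(1) by simp
  have "integral {-1<..<1} (\<lambda>x. (D v x)\<^sup>2) = integral {-1<..<1} (\<lambda>x. \<xi>\<^sup>2 * (?s x)\<^sup>2)"
    by (rule integral_cong) (subst C2(2), auto simp: power_mult_distrib)
  also have "\<dots> = \<xi>\<^sup>2 * (2 * A_const p * B_const p)"
    by (simp only: integral_mult_right integral_profile_slope_squared)
  finally show "(L2_norm_I (D v))\<^sup>2 = 2 * A_const p * B_const p * \<xi>\<^sup>2"
    using A_const_pos B_const_pos by (simp add: L2_norm_I_def mult_ac)
  show pos: "v x > 0" if "x \<in> {-1<..<1}" for x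
    using that \<xi> v[of x] profile_pos[of x] by simp
  show "v (-1) = 0" "v 1 = 0" using v[of 1] v[of "-1"] profile_values by simp_all
  show "- D (D v) x = (p + 1) / 2 * (A_const p)\<^sup>2 * \<xi> powr (1 - p) * v x powr p"
    if "x \<in> {-1<..<1}" for x
  proof -
    have "\<xi> powr (1 - p) * v x powr p = (\<xi> powr (1 - p) * \<xi> powr p) * profile p x powr p"
      using \<xi> that v[of x] profile_pos[OF that] by (simp add: powr_mult)
    also have "\<xi> powr (1 - p) * \<xi> powr p = \<xi>"
      using \<xi> by (simp flip: powr_add)
    finally show ?thesis using that C2(3)[of x] by simp
  qed
  have "(\<lambda>x. \<bar>v x\<bar>) ` {-1..1} = (\<lambda>x. \<xi> * profile p x) ` {-1..1}"
    using v profile_range \<xi> by (intro image_cong) auto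
  moreover have "Sup ((\<lambda>x. \<xi> * profile p x) ` {-1..1}) = \<xi>"
  proof (rule cSup_eq_maximum)
    show "\<xi> \<in> (\<lambda>x. \<xi> * profile p x) ` {-1..1}"
      using profile_values(3) by (intro image_eqI[of _ _ 0]) auto
    show "y \<le> \<xi>" if "y \<in> (\<lambda>x. \<xi> * profile p x) ` {-1..1}" for y
      using that profile_range \<xi> by auto
  qed
  ultimately show "max_norm v = \<xi>" by (simp add: max_norm_def)
qed

section \<open>Solution sets of the Emden and Kirchhoff problems\<close>

lemma emden_solution_iff:
  "emden_solution p W \<longleftrightarrow>
    (\<exists>m>0. (p + 1) / 2 * (A_const p)\<^sup>2 * m powr (1 - p) = 1 \<and> (\<forall>x\<in>{-1..1}. W x = m * profile p x))"
proof
  assume "emden_solution p W"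
  then have W: "W \<in> C2_Ibar" "\<And>x. x \<in> {-1<..<1} \<Longrightarrow> D (D W) x = - (1 * W x powr p)"
    "\<And>x. x \<in> {-1<..<1} \<Longrightarrow> W x > 0" "W (-1) = 0" "W 1 = 0"
    unfolding emden_solution_def by (auto simp: minus_equation_iff[of "D (D W) _"])
  obtain m where "m > 0" "1 = (p + 1) / 2 * (A_const p)\<^sup>2 * m powr (1 - p)"
    "\<And>x. x \<in> {-1..1} \<Longrightarrow> W x = m * profile p x"
    using positive_solution_eq_profile[OF W(1) zero_less_one W(2-5)] by blast
  then show "\<exists>m>0. (p + 1) / 2 * (A_const p)\<^sup>2 * m powr (1 - p) = 1 \<and> (\<forall>x\<in>{-1..1}. W x = m * profile p x)"
    by metis
next
  assume "\<exists>m>0. (p + 1) / 2 * (A_const p)\<^sup>2 * m powr (1 - p) = 1 \<and> (\<forall>x\<in>{-1..1}. W x = m * profile p x)"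
  then obtain m where m: "m > 0" "(p + 1) / 2 * (A_const p)\<^sup>2 * m powr (1 - p) = 1"
    and W: "\<forall>x\<in>{-1..1}. W x = m * profile p x" by blast
  note W' = scaled_profile[OF m(1) W]
  show "emden_solution p W"
    unfolding emden_solution_def using W'(1,3-6) m(2) by simp
qed

text \<open>Splits the formula into the Kirchhoff coefficient of \<open>\<xi> * profile p x\<close>
  and the constant \<open>k\<close> for which this function solves
  \<open>- v'' = k * v powr p\<close>.\<close>

lemma kirchhoff_parameter_eq:
  assumes "\<xi> > 0"
  shows "kirchhoff_parameter p a b \<xi> = (b + 2 * A_const p * B_const p * a * \<xi>\<^sup>2)
    * ((p + 1) / 2 * (A_const p)\<^sup>2 * \<xi> powr (1 - p))"
proof -
  have "\<xi> powr (3 - p) = \<xi>\<^sup>2 * \<xi> powr (1 - p)"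
    using assms by (simp flip: powr_numeral powr_add)
  then show ?thesis unfolding kirchhoff_parameter_def by algebra
qed

lemma kirchhoff_solution_iff:
  assumes a: "a > 0" and b: "b > 0" and \<mu>: "\<mu> > 0"
  shows "kirchhoff_solution a b p \<mu> v \<longleftrightarrow>
    (\<exists>\<xi>>0. kirchhoff_parameter p a b \<xi> = \<mu> \<and> (\<forall>x\<in>{-1..1}. v x = \<xi> * profile p x))"
proof
  assume "kirchhoff_solution a b p \<mu> v"
  then have v: "v \<in> C2_Ibar"
    "\<And>x. x \<in> {-1<..<1} \<Longrightarrow> - (b + a * (L2_norm_I (D v))\<^sup>2) * D (D v) x = \<mu> * v x powr p"
    "\<And>x. x \<in> {-1<..<1} \<Longrightarrow> v x > 0" "v (-1) = 0" "v 1 = 0"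
    by (auto simp: kirchhoff_solution_def)
  \<comment> \<open>For a given \<open>v\<close> the nonlocal coefficient is just a positive number,
    so the classification applies with \<open>k = \<mu> / M\<close>.\<close>
  define M where "M = b + a * (L2_norm_I (D v))\<^sup>2"
  have M: "M > 0" using a b by (simp add: M_def add_pos_nonneg)
  have "D (D v) x = - (\<mu> / M * v x powr p)" if "x \<in> {-1<..<1}" for x
    using v(2)[OF that] M unfolding M_def[symmetric] by (simp add: field_simps)
  from positive_solution_eq_profile[OF v(1) _ this v(3-5)] M \<mu>
  obtain m where m: "m > 0" "\<mu> / M = (p + 1) / 2 * (A_const p)\<^sup>2 * m powr (1 - p)"
    and eq: "\<forall>x\<in>{-1..1}. v x = m * profile p x" by (metis divide_pos_pos)
  \<comment> \<open>Now that \<open>v\<close> is known to be \<open>m\<close> times the profile,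
    \<open>M\<close> can be evaluated, which closes the loop between coefficient and
    amplitude.\<close>
  have "kirchhoff_parameter p a b m = M * (\<mu> / M)"
    unfolding kirchhoff_parameter_eq[OF m(1)] m(2)
    by (simp only: M_def scaled_profile(2)[OF m(1) eq] mult_ac)
  with M m(1) eq
  show "\<exists>\<xi>>0. kirchhoff_parameter p a b \<xi> = \<mu> \<and> (\<forall>x\<in>{-1..1}. v x = \<xi> * profile p x)" by auto
next
  assume "\<exists>\<xi>>0. kirchhoff_parameter p a b \<xi> = \<mu> \<and> (\<forall>x\<in>{-1..1}. v x = \<xi> * profile p x)"
  then obtain \<xi> where \<xi>: "\<xi> > 0" "kirchhoff_parameter p a b \<xi> = \<mu>"
    and v: "\<forall>x\<in>{-1..1}. v x = \<xi> * profile p x" by blast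
  note v' = scaled_profile[OF \<xi>(1) v]
  have "- (b + a * (L2_norm_I (D v))\<^sup>2) * D (D v) x = \<mu> * v x powr p" if "x \<in> {-1<..<1}" for x
  proof -
    have "- (b + a * (L2_norm_I (D v))\<^sup>2) * D (D v) x
      = (b + a * (L2_norm_I (D v))\<^sup>2) * (- D (D v) x)" by algebra
    also have "\<dots> = \<mu> * v x powr p"
      unfolding v'(2) v'(3)[OF that] \<xi>(2)[symmetric] kirchhoff_parameter_eq[OF \<xi>(1)]
      by (simp add: mult_ac)
    finally show ?thesis .
  qed
  with v'(1,4-6) show "kirchhoff_solution a b p \<mu> v"
    by (simp add: kirchhoff_solution_def)
qed

end

subsection \<open>Existence and uniqueness\<close>

text \<open>Intermediate value theorem for existence, strict monotonicity for uniqueness.\<close>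

lemma ex1_powr_sum_eq:
  fixes \<alpha> \<beta> c d y :: real
  assumes "\<alpha> > 0" "\<beta> > 0" "c > 0" "d > 0" "y > 0"
  shows "\<exists>!x. x > 0 \<and> c * x powr \<alpha> + d * x powr \<beta> = y"
proof -
  let ?f = "\<lambda>x. c * x powr \<alpha> + d * x powr \<beta>"
  \<comment> \<open>At \<open>hi\<close> the first term alone equals \<open>y\<close>; at
    \<open>lo\<close> each of the two terms is at most \<open>y / 2\<close>.\<close>
  define hi where "hi = (y / c) powr (1 / \<alpha>)"
  define lo where "lo = min (min hi ((y / (2 * c)) powr (1 / \<alpha>))) ((y / (2 * d)) powr (1 / \<beta>))"
  have pos: "0 < lo" "lo \<le> hi" using assms by (auto simp: lo_def hi_def)
  have "c * hi powr \<alpha> = y" using assms by (simp add: hi_def powr_powr)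
  then have hi: "y \<le> ?f hi" using assms by simp
  have "lo powr \<alpha> \<le> ((y / (2 * c)) powr (1 / \<alpha>)) powr \<alpha>"
    "lo powr \<beta> \<le> ((y / (2 * d)) powr (1 / \<beta>)) powr \<beta>"
    using assms pos by (auto intro!: powr_mono2 simp: lo_def)
  then have "c * lo powr \<alpha> \<le> y / 2" "d * lo powr \<beta> \<le> y / 2"
    using assms by (simp_all add: powr_powr field_simps)
  then have lo: "?f lo \<le> y" by linarith
  have "continuous_on {lo..hi} ?f"
    by (intro continuous_intros) (use pos in auto)
  then obtain x where x: "lo \<le> x" "x \<le> hi" "?f x = y"
    using IVT'[of ?f lo y hi] lo hi pos by blast
  show ?thesis
  proof (rule ex1I[of _ x])
    have less: "?f u < ?f v" if "0 < u" "u < v" for u v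
      using that assms by (intro add_strict_mono mult_strict_left_mono powr_less_mono2) auto
    show "z = x" if "z > 0 \<and> ?f z = y" for z
      using less[of z x] less[of x z] that x pos by (cases z x rule: linorder_cases) auto
  qed (use x pos in auto)
qed

text \<open>The substitution of \<open>inverse x\<close> for \<open>x\<close> reverses the signs of
  both exponents.\<close>

lemma ex1_powr_sum_eq_neg:
  fixes \<alpha> \<beta> c d y :: real
  assumes "\<alpha> < 0" "\<beta> < 0" "c > 0" "d > 0" "y > 0"
  shows "\<exists>!x. x > 0 \<and> c * x powr \<alpha> + d * x powr \<beta> = y"
proof -
  have eq: "inverse x powr \<gamma> = x powr - \<gamma>" if "x > 0" for x \<gamma> :: real
    using that by (simp add: powr_def ln_inverse)
  let ?P = "\<lambda>x. x > 0 \<and> c * x powr - \<alpha> + d * x powr - \<beta> = y"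
  have ex1: "\<exists>!x. ?P x"
    by (rule ex1_powr_sum_eq) (use assms in auto)
  then obtain x where x: "?P x" by blast
  show ?thesis
  proof (rule ex1I[of _ "inverse x"])
    show "inverse x > 0 \<and> c * inverse x powr \<alpha> + d * inverse x powr \<beta> = y"
      using x by (simp add: eq)
    fix z assume z: "z > 0 \<and> c * z powr \<alpha> + d * z powr \<beta> = y"
    then have "?P (inverse z)" by (simp add: eq)
    then have "inverse z = x" using ex1 x by blast
    then show "z = inverse x" by auto
  qed
qed

lemma ex1_kirchhoff_parameter:
  assumes "a > 0" "b > 0" "p > 0" "p < 1 \<or> 3 < p" "\<mu> > 0"
  shows "\<exists>!\<xi>. \<xi> > 0 \<and> kirchhoff_parameter p a b \<xi> = \<mu>"
proof -
  define k where "k = (p + 1) / 2 * (A_const p)\<^sup>2"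
  have A: "A_const p > 0" and B: "B_const p > 0"
    using A_const_pos B_const_pos assms(3) by auto
  have k: "k > 0" using A assms(3) by (simp add: k_def)
  have eq: "kirchhoff_parameter p a b \<xi>
      = k * (2 * A_const p * B_const p * a) * \<xi> powr (3 - p) + k * b * \<xi> powr (1 - p)" for \<xi>
    by (simp add: kirchhoff_parameter_def k_def distrib_left mult_ac)
  have pos: "k * (2 * A_const p * B_const p * a) > 0" "k * b > 0"
    using A B k assms(1,2) by simp_all
  show ?thesis
  proof (cases "p < 1")
    case True
    then have "3 - p > 0" "1 - p > 0" by simp_all
    from ex1_powr_sum_eq[OF this pos assms(5)] show ?thesis by (simp only: eq)
  next
    case False
    then have "3 - p < 0" "1 - p < 0" using assms(4) by simp_all
    from ex1_powr_sum_eq_neg[OF this pos assms(5)] show ?thesis by (simp only: eq)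
  qed
qed

text \<open>For \<open>p \<noteq> 1\<close> the amplitude equation has exactly one positive root,
  and the zero values off the interval fix the rest, so the definite description has a unique
  candidate.\<close>

lemma W_sol_eq:
  assumes p: "p > 0" "p \<noteq> 1"
  obtains m where "m > 0" "(p + 1) / 2 * (A_const p)\<^sup>2 * m powr (1 - p) = 1"
    "W_sol p = (\<lambda>x. m * profile p x)"
proof -
  define k where "k = (p + 1) / 2 * (A_const p)\<^sup>2"
  define m where "m = k powr (1 / (p - 1))"
  have k: "k > 0" using A_const_pos[OF p(1)] p(1) by (simp add: k_def)
  have exponent: "1 / (p - 1) * (1 - p) = - 1" using p(2) by (simp add: field_simps)
  have "m powr (1 - p) = k powr (- 1)"
    unfolding m_def powr_powr exponent ..
  then have m: "m > 0" "k * m powr (1 - p) = 1"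
    using k by (simp_all add: m_def powr_minus)
  have "W_sol p = (\<lambda>x. m * profile p x)"
    unfolding W_sol_def
  proof (rule the_equality)
    show "emden_solution p (\<lambda>x. m * profile p x) \<and> (\<forall>x. x \<notin> {-1..1} \<longrightarrow> m * profile p x = 0)"
      using m by (auto simp: emden_solution_iff[OF p(1)] k_def profile_def)
    fix W assume W: "emden_solution p W \<and> (\<forall>x. x \<notin> {-1..1} \<longrightarrow> W x = 0)"
    then obtain n where n: "n > 0" "k * n powr (1 - p) = 1"
      "\<And>x. x \<in> {-1..1} \<Longrightarrow> W x = n * profile p x"
      unfolding emden_solution_iff[OF p(1)] k_def by blast
    \<comment> \<open>Positive numbers are recovered from their power \<open>1 - p\<close>, which
      makes the amplitude unique.\<close>
    have root: "(y powr (1 - p)) powr (1 / (1 - p)) = y" if "y > 0" for y :: real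
      using that p(2) by (simp add: powr_powr)
    have "k * n powr (1 - p) = k * m powr (1 - p)" using n(2) m(2) by simp
    then have "n powr (1 - p) = m powr (1 - p)" using k by simp
    then have "n = m" using root[OF n(1)] root[OF m(1)] by metis
    then show "W = (\<lambda>x. m * profile p x)"
      using n(3) W by (auto simp: fun_eq_iff profile_def)
  qed
  with m that show ?thesis by (auto simp: k_def)
qed

theorem theorem1p2:
  fixes a b p :: real
  assumes "a > 0" and "b > 0" and "p > 0" and "p < 1 \<or> 3 < p"
  shows "\<exists>(u :: real \<Rightarrow> real \<Rightarrow> real) (\<Lambda> :: real \<Rightarrow> real).
    (\<forall>\<mu>>0. kirchhoff_solution a b p \<mu> (u \<mu>)
           \<and> (\<forall>v. kirchhoff_solution a b p \<mu> v \<longrightarrow> (\<forall>x\<in>{-1..1}. v x = u \<mu> x)))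
    \<and> (\<forall>\<mu>>0. max_norm (u \<mu>) > 0 \<and> \<Lambda> (max_norm (u \<mu>)) = \<mu>)
    \<and> (\<forall>\<xi>>0. \<Lambda> \<xi> > 0 \<and> max_norm (u (\<Lambda> \<xi>)) = \<xi>)
    \<and> (\<forall>\<xi>>0. \<Lambda> \<xi> = (p + 1) / 2 * (A_const p)\<^sup>2
           * (2 * A_const p * B_const p * a * \<xi> powr (3 - p) + b * \<xi> powr (1 - p)))
    \<and> (\<forall>\<mu>>0. \<forall>x\<in>{-1..1}.
         u \<mu> x = (\<mu> / (b + 2 * A_const p * B_const p * a * (inv_into {0<..} \<Lambda> \<mu>)\<^sup>2))
                  powr (1 / (1 - p)) * W_sol p x)"
proof -
  note p = \<open>p > 0\<close>
  define \<Lambda> where "\<Lambda> = kirchhoff_parameter p a b"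
  define k where "k = (p + 1) / 2 * (A_const p)\<^sup>2"
  have A: "A_const p > 0" and B: "B_const p > 0"
    using A_const_pos[OF p] B_const_pos[OF p] .
  have k: "k > 0" using A p by (simp add: k_def)
  have M_pos: "b + 2 * A_const p * B_const p * a * \<xi>\<^sup>2 > 0" for \<xi>
    using assms(1,2) A B by (simp add: add_pos_nonneg)
  have \<Lambda>_eq: "\<Lambda> \<xi> = (b + 2 * A_const p * B_const p * a * \<xi>\<^sup>2) * (k * \<xi> powr (1 - p))"
    if "\<xi> > 0" for \<xi>
    using kirchhoff_parameter_eq[OF p that] by (simp add: \<Lambda>_def k_def)
  have \<Lambda>_pos: "\<Lambda> \<xi> > 0" if "\<xi> > 0" for \<xi>
    using that k M_pos by (simp add: \<Lambda>_eq)
  have ex1: "\<exists>!\<xi>. \<xi> > 0 \<and> \<Lambda> \<xi> = \<mu>" if "\<mu> > 0" for \<mu>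
    using ex1_kirchhoff_parameter[OF assms that] by (simp add: \<Lambda>_def)
  define X where "X = inv_into {0<..} \<Lambda>"
  have X: "X \<mu> > 0" "\<Lambda> (X \<mu>) = \<mu>" if "\<mu> > 0" for \<mu>
  proof -
    have "\<mu> \<in> \<Lambda> ` {0<..}" using ex1[OF that] by auto
    then show "X \<mu> > 0" "\<Lambda> (X \<mu>) = \<mu>"
      using inv_into_into[of \<mu> \<Lambda> "{0<..}"] f_inv_into_f[of \<mu> \<Lambda> "{0<..}"] by (auto simp: X_def)
  qed
  have X_\<Lambda>: "X (\<Lambda> \<xi>) = \<xi>" if "\<xi> > 0" for \<xi>
    using ex1[OF \<Lambda>_pos[OF that]] X[OF \<Lambda>_pos[OF that]] that by blast
  \<comment> \<open>The amplitude is the unique \<open>\<xi>\<close> with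
    \<open>\<Lambda> \<xi> = \<mu>\<close>.\<close>
  define u where "u \<mu> x = X \<mu> * profile p x" for \<mu> x
  have sol: "kirchhoff_solution a b p \<mu> v \<longleftrightarrow> (\<forall>x\<in>{-1..1}. v x = u \<mu> x)" if "\<mu> > 0" for \<mu> v
    unfolding kirchhoff_solution_iff[OF p assms(1,2) that] u_def \<Lambda>_def[symmetric]
    using X[OF that] X_\<Lambda> by metis
  have max_u: "max_norm (u \<mu>) = X \<mu>" if "\<mu> > 0" for \<mu>
    by (rule scaled_profile(7)[OF p X(1)[OF that]]) (simp add: u_def)
  have p1: "p \<noteq> 1" using assms(4) by auto
  obtain m where m: "m > 0" "k * m powr (1 - p) = 1" and W: "W_sol p = (\<lambda>x. m * profile p x)"
    unfolding k_def by (rule W_sol_eq[OF p p1])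
  have u_W: "u \<mu> x = (\<mu> / (b + 2 * A_const p * B_const p * a * (X \<mu>)\<^sup>2)) powr (1 / (1 - p)) * W_sol p x"
    if "\<mu> > 0" for \<mu> x
  proof -
    note \<xi> = X[OF that]
    have "\<mu> / (b + 2 * A_const p * B_const p * a * (X \<mu>)\<^sup>2) = k * X \<mu> powr (1 - p)"
      using \<Lambda>_eq[OF \<xi>(1)] \<xi>(2) M_pos[of "X \<mu>"] by (simp add: field_simps)
    \<comment> \<open>The amplitude equation of \<open>W_sol\<close> turns \<open>k\<close> into
      \<open>1 / m powr (1 - p)\<close>, so the root of exponent \<open>1 - p\<close> yields the
      ratio of the two amplitudes.\<close>
    also have "\<dots> = X \<mu> powr (1 - p) / m powr (1 - p)"
      using m by (simp add: field_simps)
    also have "\<dots> = (X \<mu> / m) powr (1 - p)"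
      using m(1) \<xi>(1) by (simp add: powr_divide)
    finally have "(\<mu> / (b + 2 * A_const p * B_const p * a * (X \<mu>)\<^sup>2)) powr (1 / (1 - p)) = X \<mu> / m"
      using m(1) \<xi>(1) assms(4) by (auto simp: powr_powr)
    then show ?thesis using m(1) by (simp add: u_def W)
  qed
  show ?thesis
  proof (intro exI[of _ u] exI[of _ \<Lambda>] conjI allI impI ballI)
    fix \<xi> :: real assume "\<xi> > 0"
    show "\<Lambda> \<xi> = (p + 1) / 2 * (A_const p)\<^sup>2
      * (2 * A_const p * B_const p * a * \<xi> powr (3 - p) + b * \<xi> powr (1 - p))"
      by (simp only: \<Lambda>_def kirchhoff_parameter_def)
  qed (use sol max_u X \<Lambda>_pos X_\<Lambda> u_W in \<open>simp_all add: X_def\<close>)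
qed

end
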